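(* Let $n$ be an even natural number. Then the maximum size $r(2,\mathbb{F}_3^n)$ of a $2$-cap in $\mathbb{F}_3^n$ equals $3^{n/2}$.
   Context: $\mathbb{F}_3^n$ denotes $n$-dimensional affine space over the field with three elements. A $k$-dimensional flat is a $k$-dimensional affine subspace. For $d \in \mathbb{N}$, a subset $C \subseteq \mathbb{F}_3^n$ is a $d$-cap if, for each $k=1,\dots,d$, no $k+2$ points of $C$ lie on a $k$-dimensional flat (equivalently, every subset of $C$ of size at most $d+2$ is affinely independent). In particular, a $2$-cap is a set with no three collinear points and no four coplanar points. $r(d,\mathbb{F}_3^n)$ denotes the largest cardinality of a $d$-cap in $\mathbb{F}_3^n$. *)

theory Defs
  imports "Jordan_Normal_Form.VS_Connect" "HOL-Library.Cardinality"
begin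

text \<open>The space \<open>F\<^sup>n\<close> is \<^term>\<open>carrier_vec n\<close>, and a \<open>k\<close>-dimensional flat is a translate
  \<open>p + W\<close> of a \<open>k\<close>-dimensional linear subspace \<open>W\<close> of it. The record update equips \<open>W\<close> with the
  operations of \<open>F\<^sup>n\<close>, so that its dimension can be taken.\<close>

definition flat :: "nat \<Rightarrow> nat \<Rightarrow> 'a::field vec set \<Rightarrow> bool" where
  "flat n k A \<longleftrightarrow>
     (\<exists>p W. p \<in> carrier_vec n
        \<and> VectorSpace.subspace class_ring W (module_vec TYPE('a) n)
        \<and> vectorspace.dim class_ring ((module_vec TYPE('a) n)\<lparr>carrier := W\<rparr>) = k
        \<and> A = (\<lambda>w. p + w) ` W)"

definition d_cap :: "nat \<Rightarrow> nat \<Rightarrow> 'a::field vec set \<Rightarrow> bool" where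
  "d_cap d n C \<longleftrightarrow>
     C \<subseteq> carrier_vec n
     \<and> (\<forall>k\<in>{1..d}. \<not> (\<exists>S A. S \<subseteq> C \<and> card S = k + 2 \<and> flat n k A \<and> S \<subseteq> A))"

text \<open>The maximum is meaningful for a finite field only, where \<open>F\<^sup>n\<close> has finitely many subsets;
  the empty set is always a \<open>d\<close>-cap.\<close>

definition max_cap :: "'a::field itself \<Rightarrow> nat \<Rightarrow> nat \<Rightarrow> nat" where
  "max_cap _ d n = Max {card C | C :: 'a vec set. d_cap d n C}"

end

theory Submission
  imports Defs "HOL-Algebra.Algebraic_Closure_Type"
begin

text \<open>Over a field with three elements, an affine dependence among at most four distinct points has
  the form \<open>x + x = y + z\<close> or \<open>a + b = c + d\<close>. Hence a set is a \<open>2\<close>-cap if and only if it is a Sidon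
  set: sums of two elements determine the summands up to order. In a Sidon set \<open>C\<close> the differences
  of ordered pairs of distinct points are pairwise distinct and nonzero, so \<open>|C| (|C| - 1) < 3 ^ n\<close>,
  which forces \<open>|C| \<le> 3 ^ (n / 2)\<close>. The same count inside a flat shows that a Sidon set cannot have
  three points on a line or four points on a plane. The bound is attained by the parabola
  \<open>{(x, x\<^sup>2)}\<close> over the field with \<open>3 ^ (n / 2)\<close> elements, since in odd characteristic
  \<open>x + y\<close> and \<open>x\<^sup>2 + y\<^sup>2\<close> determine the pair \<open>{x, y}\<close>. That field consists of the roots of
  \<open>X ^ q - X\<close> in the algebraic closure, and a basis over the prime field identifies it additively
  with a coordinate space.\<close>

unbundle no Formal_Power_Series.fps_syntax

section \<open>Vector spaces over finite fields\<close>

lemma card_carrier_vec_finite: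
  assumes "finite (UNIV :: 'a set)"
  shows "finite (carrier_vec n :: 'a vec set)" and "card (carrier_vec n :: 'a vec set) = CARD('a) ^ n"
proof -
  let ?L = "{xs :: 'a list. set xs \<subseteq> UNIV \<and> length xs = n}"
  have bij: "bij_betw vec_of_list ?L (carrier_vec n)"
  by (rule bij_betw_byWitness[where f' = list_of_vec])
      (auto simp: list_vec vec_list intro: carrier_vecI)
  show "finite (carrier_vec n :: 'a vec set)"
    using bij_betw_finite[OF bij] finite_lists_length_eq[OF assms] by simp
  show "card (carrier_vec n :: 'a vec set) = CARD('a) ^ n"
    using bij_betw_same_card[OF bij] card_lists_length_eq[OF assms] by simp
qed

text \<open>Sending coefficients to linear combinations of a fixed basis is an additive bijection,
  and \<open>f\<close> is its inverse. Only additivity is recorded, since the Sidon property speaks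
  of sums alone.\<close>

lemma vectorspace_coordinates:
  fixes V :: "('a::field, 'b, 'c) module_scheme"
  assumes "vectorspace class_ring V" and "finite (carrier V)"
  obtains f :: "'b \<Rightarrow> 'a vec" where "bij_betw f (carrier V) (carrier_vec (vectorspace.dim class_ring V))"
    and "\<And>x y. x \<in> carrier V \<Longrightarrow> y \<in> carrier V \<Longrightarrow> f (x \<oplus>\<^bsub>V\<^esub> y) = f x + f y"
proof -
  interpret vectorspace "class_ring :: 'a ring" V by fact
  \<comment> \<open>A finite carrier is a finite spanning set of itself, hence
    \<open>fin_dim\<close>.\<close>
  have "span (carrier V) = carrier V"
    using in_own_span[of "carrier V"] span_is_subset2[of "carrier V"] by auto
  then have "fin_dim" unfolding fin_dim_def using assms(2) by blast
  then obtain B where B: "finite B" "basis B" using finite_basis_exists by blast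
  then have BV: "B \<subseteq> carrier V" and dim: "dim = card B"
    using dim_basis by (auto simp: basis_def)
  obtain g where g: "bij_betw g {0..<card B} B" using ex_bij_betw_nat_finite[OF B(1)] by blast
  define j where "j = inv_into {0..<card B} g"
  let ?F = "\<lambda>u. lincomb (\<lambda>b. u $ j b) B"
  have inv: "j (g i) = i" if "i < card B" for i
    using bij_betw_inv_into_left[OF g] that by (simp add: j_def)
  have gB: "g i \<in> B" if "i < card B" for i using bij_betwE[OF g] that by simp
  have inv2: "j b < card B" "g (j b) = b"
    if "b \<in> B" for b
    using bij_betw_inv_into_right[OF g that] bij_betwE[OF bij_betw_inv_into[OF g]] that by (auto simp: j_def)
  have ex1: "\<exists>!a. a \<in> B \<rightarrow>\<^sub>E UNIV \<and> lincomb a B = v" if "v \<in> carrier V" for v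
    using basis_criterion[OF B(1) BV] B(2) that by auto
  \<comment> \<open>Coefficient functions are unique only among those extensional on
    \<open>B\<close>, so they are compared after restriction to \<open>B\<close>.\<close>
  have restr: "lincomb (restrict a B) B = lincomb a B" for a
    by (rule lincomb_cong) (use BV in auto)
  have bij: "bij_betw ?F (carrier_vec (card B)) (carrier V)"
  proof (rule bij_betwI')
    fix u w :: "'a vec" assume u: "u \<in> carrier_vec (card B)" and w: "w \<in> carrier_vec (card B)"
    show "?F u = ?F w \<longleftrightarrow> u = w"
    proof
      assume eq: "?F u = ?F w"
      let ?r = "\<lambda>u. restrict (\<lambda>b. u $ j b) B"
      have "?F u \<in> carrier V" using BV by auto
      then have "?r u = ?r w"
        using ex1[of "?F u"] eq restr by (metis restrict_PiE_iff UNIV_I)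
      then have "?r u (g i) = ?r w (g i)" for i by simp
      then have "u $ i = w $ i" if "i < card B" for i
        using that gB[OF that] inv[OF that] by (metis restrict_apply')
      then show "u = w" using u w by (intro eq_vecI) auto
    qed simp
  next
    fix u :: "'a vec" assume u: "u \<in> carrier_vec (card B)"
    show "?F u \<in> carrier V" using BV by auto
  next
    fix v assume "v \<in> carrier V"
    then obtain a where a: "lincomb a B = v" using ex1 by blast
    have "?F (vec (card B) (\<lambda>i. a (g i))) = lincomb a B"
      by (rule lincomb_cong) (use BV inv2 in auto)
    then show "\<exists>u\<in>carrier_vec (card B). v = ?F u" using a vec_carrier by metis
  qed
  have add: "?F (u + w) = ?F u \<oplus>\<^bsub>V\<^esub> ?F w"
    if "u \<in> carrier_vec (card B)" "w \<in> carrier_vec (card B)" for u w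
  proof -
    have "?F (u + w) = lincomb (\<lambda>b. u $ j b \<oplus>\<^bsub>class_ring\<^esub> w $ j b) B"
      by (rule lincomb_cong) (use BV inv2 that in auto)
    also have "\<dots> = ?F u \<oplus>\<^bsub>V\<^esub> ?F w"
      by (rule lincomb_sum[OF B(1) BV]) auto
    finally show ?thesis .
  qed
  define f where "f = inv_into (carrier_vec (card B)) ?F"
  have f: "bij_betw f (carrier V) (carrier_vec dim)"
    unfolding dim f_def by (rule bij_betw_inv_into[OF bij])
  have "f (x \<oplus>\<^bsub>V\<^esub> y) = f x + f y" if x: "x \<in> carrier V" and y: "y \<in> carrier V" for x y
  proof -
    have fxy: "f x \<in> carrier_vec (card B)" "f y \<in> carrier_vec (card B)"
      using bij_betwE[OF f] x y dim by auto
    have "?F (f x + f y) = ?F (f x) \<oplus>\<^bsub>V\<^esub> ?F (f y)" by (rule add[OF fxy])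
    also have "?F (f x) = x" unfolding f_def by (rule bij_betw_inv_into_right[OF bij x])
    also have "?F (f y) = y" unfolding f_def by (rule bij_betw_inv_into_right[OF bij y])
    finally show ?thesis
      using bij_betw_inv_into_left[OF bij, of "f x + f y"] fxy unfolding f_def[symmetric] by simp
  qed
  with f show thesis by (rule that)
qed

lemma card_vectorspace:
  fixes V :: "('a::field, 'b, 'c) module_scheme"
  assumes "vectorspace class_ring V" and "finite (carrier V)" and "finite (UNIV :: 'a set)"
  shows "card (carrier V) = CARD('a) ^ vectorspace.dim class_ring V"
proof -
  obtain f :: "'b \<Rightarrow> 'a vec" where "bij_betw f (carrier V) (carrier_vec (vectorspace.dim class_ring V))"
    using vectorspace_coordinates[OF assms(1,2)] by blast
  then show ?thesis using bij_betw_same_card card_carrier_vec_finite(2)[OF assms(3)] by metis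
qed

section \<open>Finite fields of characteristic three\<close>

text \<open>Translation by 1 permutes the ring, so adding 1 to each element leaves the sum of all
  elements unchanged.\<close>

lemma of_nat_CARD_eq_0:
  assumes "finite (UNIV :: 'a::ring_1 set)"
  shows "of_nat CARD('a) = (0 :: 'a)"
proof -
  have "(\<Sum>x\<in>UNIV. x + 1) = (\<Sum>x\<in>(UNIV :: 'a set). x)"
    by (rule sum.reindex_bij_witness[where i = "\<lambda>x. x - 1" and j = "\<lambda>x. x + 1"]) auto
  then show ?thesis by (simp add: sum.distrib)
qed

lemma finite_UNIV_if_CARD_eq_3: "CARD('a) = 3 \<Longrightarrow> finite (UNIV :: 'a set)"
  by (metis card.infinite zero_neq_numeral)

lemma CHAR_eq_3:
  assumes "CARD('a::field) = 3"
  shows "CHAR('a) = 3"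
proof -
  have "CHAR('a) dvd 3"
    using of_nat_CARD_eq_0[OF finite_UNIV_if_CARD_eq_3[OF assms]] assms
      of_nat_eq_0_iff_char_dvd[where 'a='a] by metis
  moreover have "Factorial_Ring.prime (3::nat)" by simp
  ultimately show ?thesis using CHAR_not_1'[where 'a = 'a] by (auto simp: prime_nat_iff)
qed

text \<open>With q = \<open>CHAR('a) ^ k\<close>, the polynomial X^q - X splits into q linear
  factors, and these are distinct because its derivative is the constant -1.\<close>

lemma card_roots_Frobenius:
  assumes "Factorial_Ring.prime CHAR('a::alg_closed_field)" and "k > 0"
  defines "K \<equiv> {x :: 'a. x ^ (CHAR('a) ^ k) = x}"
  shows "finite K" and "card K = CHAR('a) ^ k"
proof -
  let ?q = "CHAR('a) ^ k"
  define p :: "'a poly" where "p = Polynomial.monom 1 ?q - Polynomial.monom 1 1"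
  have q: "?q > 1" using assms prime_gt_1_nat by (metis one_less_power)
  have coeff: "Polynomial.coeff p ?q = 1" unfolding p_def using q by (simp add: coeff_monom)
  have deg: "Polynomial.degree p = ?q"
  proof (rule antisym)
    show "Polynomial.degree p \<le> ?q" unfolding p_def using q
      by (intro degree_diff_le order.trans[OF degree_monom_le]) auto
    show "?q \<le> Polynomial.degree p" using coeff by (intro le_degree) auto
  qed
  have "p \<noteq> 0" using coeff by auto
  then obtain A where A: "size A = ?q" "p = (\<Prod>x\<in>#A. [:-x, 1:])"
    using alg_closed_imp_factorization[of p] coeff deg by auto
  have poly: "poly p x = x ^ ?q - x" for x by (simp add: p_def poly_monom)
  have K: "K = set_mset A"
  proof -
    have "x \<in> K \<longleftrightarrow> poly p x = 0" for x by (simp add: K_def poly)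
    also have "poly p x = 0 \<longleftrightarrow> x \<in># A" for x
      unfolding A(2) by (auto simp: poly_prod_mset prod_mset_zero_iff)
    finally show ?thesis by blast
  qed
  \<comment> \<open>As k > 0, q is a multiple of the characteristic, so the term q X^(q-1) of the
    derivative vanishes.\<close>
  have q0: "(of_nat ?q :: 'a) = 0" using assms(2) by simp
  have pderiv: "poly (pderiv p) x = - 1" for x
    unfolding p_def pderiv_diff pderiv_monom poly_diff poly_monom q0 by simp
  \<comment> \<open>A repeated root would also be a root of the derivative.\<close>
  have "count A x \<le> 1" for x
  proof (rule ccontr)
    assume "\<not> count A x \<le> 1"
    then have "{#x, x#} \<subseteq># A" by (auto intro!: mset_subset_eqI)
    then obtain C where "A = {#x, x#} + C" by (metis subset_mset.le_iff_add)
    then have "p = [:-x, 1:] * ([:-x, 1:] * (\<Prod>x\<in>#C. [:-x, 1:]))" by (simp add: A(2))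
    then have "poly (pderiv p) x = 0" by (simp add: pderiv_mult del: mult_pCons_left)
    then show False using pderiv[of x] by simp
  qed
  then have "card (set_mset A) = size A"
    unfolding size_multiset_overloaded_eq
    by (subst sum.cong[OF refl, of _ _ "\<lambda>_. 1"]) (auto simp: le_antisym Suc_leI)
  then show "card K = ?q" using A K by simp
  show "finite K" using K by simp
qed

lemma three_times_eq_0:
  assumes "CARD('a::field) = 3"
  shows "t + t + t = (0 :: 'a)"
proof -
  have "(3 :: 'a) = 0"
    using of_nat_CARD_eq_0[OF finite_UNIV_if_CARD_eq_3[OF assms]] assms by simp
  moreover have "t + t + t = 3 * t" by simp
  ultimately show ?thesis by simp
qed

lemma field_3_cases:
  assumes "CARD('a::field) = 3"
  obtains "c = (0 :: 'a)" | "c = 1" | "c = - 1"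
proof -
  have "(1 :: 'a) \<noteq> - 1"
  proof
    assume "(1 :: 'a) = - 1"
    then have "(1 :: 'a) + 1 = 0" by (metis add.right_inverse)
    then show False using three_times_eq_0[OF assms, of 1] by simp
  qed
  then have "card {0, 1, - 1 :: 'a} = CARD('a)" using assms by simp
  then have "{0, 1, - 1} = (UNIV :: 'a set)"
    using finite_UNIV_if_CARD_eq_3[OF assms] by (intro card_subset_eq) auto
  then have "c \<in> {0, 1, - 1}" by simp
  then show thesis using that by auto
qed

text \<open>\<open>K\<close> is the field with 3^k elements, viewed as a vector space over
  \<open>'a\<close>: the map x -> x^(3^k) is additive, multiplicative and fixes the scalars, so its
  fixed points are closed under addition and scaling. Counting then determines the
  dimension.\<close>

lemma field_3_additive_coordinates:
  assumes "CARD('a::field) = 3" and "k > 0"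
  defines "K \<equiv> {x :: 'a::field alg_closure. x ^ (3 ^ k) = x}"
  obtains c :: "'a::field alg_closure \<Rightarrow> 'a vec" where "bij_betw c K (carrier_vec k)"
    and "\<And>x y. x \<in> K \<Longrightarrow> y \<in> K \<Longrightarrow> c (x + y) = c x + c y"
proof -
  note CHAR = CHAR_eq_3[OF assms(1)]
  have K: "finite K" "card K = 3 ^ k"
    using card_roots_Frobenius[where 'a = "'a alg_closure", of k] assms(2)
    by (simp_all add: CHAR K_def)
  have add: "x + y \<in> K" if "x \<in> K" "y \<in> K" for x y
    using freshmans_dream'[of "3 ^ k" k x y] that by (simp add: CHAR K_def)
  have cube: "a ^ 3 ^ j = a" for a :: 'a and j
  proof (induction j)
    case (Suc j)
    have "a ^ 3 ^ Suc j = (a ^ 3 ^ j) ^ 3" by (simp only: power_Suc2 power_mult)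
    also have "\<dots> = a ^ 3" using Suc.IH by simp
    also have "\<dots> = a" by (rule field_3_cases[OF assms(1), of a]) (simp_all add: power3_eq_cube)
    finally show ?case .
  qed simp
  have smult: "to_ac a * x \<in> K" if "x \<in> K" for a :: 'a and x
    using that by (simp add: K_def power_mult_distrib cube flip: to_ac_power)
  define V :: "('a, 'a alg_closure) module" where
    "V = \<lparr>carrier = K, monoid.mult = (*), one = 1, zero = 0, add = (+),
      module.smult = (\<lambda>a x. to_ac a * x)\<rparr>"
  have neg: "- x \<in> K" if "x \<in> K" for x using smult[OF that, of "- 1"] by simp
  have vs: "vectorspace class_ring V"
  proof (rule vs_criteria[OF class_field])
    show "\<forall>v\<in>carrier V. \<exists>neg_v\<in>carrier V. v \<oplus>\<^bsub>V\<^esub> neg_v = \<zero>\<^bsub>V\<^esub>"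
      using neg by (auto simp: V_def intro!: bexI[of _ "- v" for v])
  qed (use add smult in \<open>auto simp: V_def K_def algebra_simps\<close>)
  \<comment> \<open>The size 3^k of \<open>K\<close> equals 3 to the dimension, so the dimension is
    k.\<close>
  have "card (carrier V) = CARD('a) ^ vectorspace.dim class_ring V"
    by (rule card_vectorspace[OF vs]) (use K finite_UNIV_if_CARD_eq_3[OF assms(1)] in \<open>simp_all add: V_def\<close>)
  then have "vectorspace.dim class_ring V = k" using K(2) assms(1) by (simp add: V_def)
  moreover obtain f :: "'a alg_closure \<Rightarrow> 'a vec"
    where "bij_betw f (carrier V) (carrier_vec (vectorspace.dim class_ring V))"
      "\<And>x y. x \<in> carrier V \<Longrightarrow> y \<in> carrier V \<Longrightarrow> f (x \<oplus>\<^bsub>V\<^esub> y) = f x + f y"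
    by (rule vectorspace_coordinates[OF vs]) (use K in \<open>simp_all add: V_def\<close>)
  ultimately show thesis by (intro that[of f]) (simp_all add: V_def)
qed

section \<open>Caps and Sidon sets\<close>

text \<open>The four elements may coincide, so a + a = c + d is covered as well. Only
  \<open>plus\<close> is asked of the type: vectors of all dimensions share one type, which has no
  common zero.\<close>

definition sidon :: "'a::plus set \<Rightarrow> bool" where
  "sidon S \<longleftrightarrow> (\<forall>a\<in>S. \<forall>b\<in>S. \<forall>c\<in>S. \<forall>d\<in>S. a + b = c + d \<longrightarrow> (a = c \<and> b = d) \<or> (a = d \<and> b = c))"

lemma sidonD:
  "sidon S \<Longrightarrow> a \<in> S \<Longrightarrow> b \<in> S \<Longrightarrow> c \<in> S \<Longrightarrow> d \<in> S \<Longrightarrow> a + b = c + d \<Longrightarrow>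
    (a = c \<and> b = d) \<or> (a = d \<and> b = c)"
  by (simp add: sidon_def)

lemma sidon_subset: "sidon S \<Longrightarrow> T \<subseteq> S \<Longrightarrow> sidon T"
  by (auto simp: sidon_def subset_iff)

text \<open>Ordered pairs of distinct points of \<open>C\<close> have different differences, all in
  \<open>W\<close> without 0, because the translation by \<open>p\<close> cancels. Taking for
  \<open>W\<close> the whole space bounds a Sidon set; taking the direction space of a flat bounds
  its part in that flat.\<close>

lemma card_sidon_less:
  fixes C :: "'a::field vec set"
  assumes "sidon C" and "C \<subseteq> (\<lambda>w. p + w) ` W" and "p \<in> carrier_vec n"
    and W: "finite W" "W \<subseteq> carrier_vec n" "0\<^sub>v n \<in> W"
    and minus: "\<And>x y. x \<in> W \<Longrightarrow> y \<in> W \<Longrightarrow> x - y \<in> W"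
  shows "card C * (card C - 1) < card W"
proof -
  have C: "x \<in> carrier_vec n" if "x \<in> C" for x
    using subsetD[OF assms(2) that] assms(3) W(2) by (auto intro: add_carrier_vec)
  have fin: "finite C" using assms(2) W(1) finite_surj by blast
  let ?D = "SIGMA x:C. C - {x}"
  have inj: "inj_on (\<lambda>(x, y). x - y) ?D"
  proof (rule inj_onI)
    have key: "x = z \<and> y = w"
      if xy: "x \<in> C" "y \<in> C" "y \<noteq> x" "z \<in> C" "w \<in> C" and eq: "x - y = z - w" for x y z w
    proof -
      note car = C[OF xy(1)] C[OF xy(2)] C[OF xy(4)] C[OF xy(5)]
      \<comment> \<open>As an equation of sums this is open to the Sidon property, whose other
        alternative x = y is excluded.\<close>
      have "x + w = z + y"
      proof (rule eq_vecI)
        fix i assume "i < dim_vec (z + y)"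
        then have i: "i < n" using car by auto
        have "(x - y) $ i = (z - w) $ i" using eq by simp
        then show "(x + w) $ i = (z + y) $ i" using i car by (simp add: algebra_simps)
      qed (use car in auto)
      then show ?thesis using sidonD[OF assms(1)] xy by metis
    qed
    fix s t
    assume "s \<in> ?D" "t \<in> ?D" "(case s of (x, y) \<Rightarrow> x - y) = (case t of (x, y) \<Rightarrow> x - y)"
    then show "s = t" using key[of "fst s" "snd s" "fst t" "snd t"] by (cases s; cases t) simp
  qed
  have "(\<lambda>(x, y). x - y) ` ?D \<subseteq> W - {0\<^sub>v n}"
  proof (rule image_subsetI)
    fix s assume "s \<in> ?D"
    then obtain x y where s: "s = (x, y)" and xy: "x \<in> C" "y \<in> C" "y \<noteq> x" by blast
    then obtain v w where v: "v \<in> W" "x = p + v" and w: "w \<in> W" "y = p + w" using assms(2) by blast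
    have vw: "v \<in> carrier_vec n" "w \<in> carrier_vec n" using v w W by auto
    have car: "x \<in> carrier_vec n" "y \<in> carrier_vec n" using C xy by simp_all
    have "x - y = v - w" using v w vw assms(3) by (intro eq_vecI) auto
    then have "x - y \<in> W" using minus v w by simp
    moreover have "x - y \<noteq> 0\<^sub>v n"
    proof
      assume eq: "x - y = 0\<^sub>v n"
      have "x = y"
      proof (rule eq_vecI)
        fix i assume "i < dim_vec y"
        then have i: "i < n" using car by auto
        have "(x - y) $ i = 0" using eq i by simp
        then show "x $ i = y $ i" using i car by auto
      qed (use car in auto)
      then show False using xy by simp
    qed
    ultimately show "(case s of (x, y) \<Rightarrow> x - y) \<in> W - {0\<^sub>v n}" using s by simp
  qed
  then have "card ?D \<le> card (W - {0\<^sub>v n})"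
    using inj card_inj_on_le W(1) by blast
  also have "\<dots> < card W" by (rule card_Diff1_less[OF W(1,3)])
  finally show ?thesis using fin by (simp add: card_SigmaI card_Diff_singleton)
qed

text \<open>This turns a flat into the plain data that the counting of differences takes: a finite
  set of directions of known size, closed under subtraction.\<close>

lemma flatE:
  fixes A :: "'a::field vec set"
  assumes "flat n k A" and finU: "finite (UNIV :: 'a set)"
  obtains p W where "p \<in> carrier_vec n" "W \<subseteq> carrier_vec n" "finite W" "card W = CARD('a) ^ k"
    "0\<^sub>v n \<in> W" "\<And>x y. x \<in> W \<Longrightarrow> y \<in> W \<Longrightarrow> x - y \<in> W" "A = (\<lambda>w. p + w) ` W"
proof -
  interpret vec_space "TYPE('a)" n .
  obtain p W where p: "p \<in> carrier_vec n" and W: "VectorSpace.subspace class_ring W V"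
    and dim: "vectorspace.dim class_ring (vs W) = k" and A: "A = (\<lambda>w. p + w) ` W"
    using assms(1) unfolding flat_def by blast
  interpret W: LinearCombinations.submodule class_ring W V by (rule subspace.submod[OF W])
  have car: "W \<subseteq> carrier_vec n" using W.subset by simp
  have finW: "finite W" by (rule finite_subset[OF car card_carrier_vec_finite(1)[OF finU]])
  have card: "card W = CARD('a) ^ k"
    using card_vectorspace[OF subspace_is_vs[OF W] _ finU] finW dim by simp
  have minus: "x - y \<in> W" if xy: "x \<in> W" "y \<in> W" for x y
  proof -
    have "(-1) \<cdot>\<^sub>v y \<in> W" using W.smult_closed[of "-1" y] xy by simp
    then have "x + (-1) \<cdot>\<^sub>v y \<in> W" using W.m_closed xy by simp
    moreover have "x + (-1) \<cdot>\<^sub>v y = x - y" using xy car by (intro eq_vecI) auto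
    ultimately show ?thesis by simp
  qed
  have "0\<^sub>v n \<in> W" using W.zero_closed by simp
  with p car finW card show thesis using minus A by (rule that)
qed

context vec_space
begin

text \<open>A linearly independent set stays independent inside its span, so it is a basis there and
  its size is the dimension. This supplies the lines and planes that a cap must avoid.\<close>

lemma flat_span:
  assumes "p \<in> carrier_vec n" "finite S" "S \<subseteq> carrier_vec n" "lin_indpt S"
  shows "flat n (card S) ((\<lambda>w. p + w) ` span S)"
proof -
  have sub: "VectorSpace.subspace class_ring (span S) V" using span_is_subspace assms by simp
  have sm: "submodule class_ring (span S) V" using sub by (simp add: subspace_def)
  have S: "S \<subseteq> span S" using in_own_span assms by simp
  interpret U: vectorspace class_ring "vs (span S)" by (rule subspace_is_vs[OF sub])
  have "U.basis S" unfolding U.basis_def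
    using span_li_not_depend[OF S sm] assms(4) S by simp
  then have "U.dim = card S" using U.dim_basis assms(2) by blast
  then show ?thesis unfolding flat_def using assms(1) sub by blast
qed

lemma lin_indpt_singleton:
  assumes "u \<in> carrier_vec n" "u \<noteq> 0\<^sub>v n"
  shows "lin_indpt {u}"
proof (rule finite_lin_indpt2)
  fix a assume "lincomb a {u} = 0\<^sub>v n"
  then have 0: "a u \<cdot>\<^sub>v u = 0\<^sub>v n" using assms by (simp add: lincomb_def)
  obtain i where i: "i < n" "u $ i \<noteq> 0" using assms by (metis carrier_vecD eq_vecI index_zero_vec)
  have "(a u \<cdot>\<^sub>v u) $ i = 0" using 0 i by simp
  then show "\<forall>v\<in>{u}. a v = 0" using i assms by auto
qed (use assms in auto)

lemma lin_indpt_pair: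
  assumes u: "u \<in> carrier_vec n" "u \<noteq> 0\<^sub>v n" and v: "v \<in> carrier_vec n" "\<And>c. v \<noteq> c \<cdot>\<^sub>v u"
  shows "lin_indpt {u, v}"
proof -
  have "v \<noteq> u" using v(2)[of 1] by auto
  have "span {u} = {c \<cdot>\<^sub>v u | c. True}"
    using u by (subst finite_span) (auto simp: lincomb_def intro: exI[of _ "\<lambda>_. c" for c])
  then have "v \<notin> span {u}" using v(2) by auto
  then have "lin_indpt ({u} \<union> {v})"
    using lin_dep_iff_in_span[of "{u}" v] lin_indpt_singleton u v(1) \<open>v \<noteq> u\<close> by auto
  then show ?thesis by (simp add: insert_commute)
qed

end

text \<open>Counting differences inside the flat, three points on a line would give 6 < 3, and four
  points on a plane 12 < 9.\<close>

lemma d_cap_if_sidon: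
  fixes C :: "'a::field vec set"
  assumes "CARD('a) = 3" and C: "C \<subseteq> carrier_vec n" and "sidon C"
  shows "d_cap 2 n C"
  unfolding d_cap_def
proof (intro conjI ballI notI C)
  fix k :: nat
  assume k: "k \<in> {1..2}" and "\<exists>S A. S \<subseteq> C \<and> card S = k + 2 \<and> flat n k A \<and> S \<subseteq> A"
  then obtain S A where S: "S \<subseteq> C" "card S = k + 2" "flat n k A" "S \<subseteq> A" by blast
  obtain p W where W: "p \<in> carrier_vec n" "W \<subseteq> carrier_vec n" "finite W" "card W = CARD('a) ^ k"
    "0\<^sub>v n \<in> W" "\<And>x y. x \<in> W \<Longrightarrow> y \<in> W \<Longrightarrow> x - y \<in> W" "A = (\<lambda>w. p + w) ` W"
    using flatE[OF S(3) finite_UNIV_if_CARD_eq_3[OF assms(1)]] by metis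
  have "card S * (card S - 1) < card W"
    by (rule card_sidon_less[of S p W n]) (use W S(4) sidon_subset[OF assms(3) S(1)] in auto)
  moreover have "k = 1 \<or> k = 2" using k by auto
  ultimately show False using S(2) W(4) assms(1) by auto
qed

text \<open>A nontrivial coincidence of sums puts three points on a line (\<open>line\<close>) or,
  when all four points are distinct, four points on a plane.\<close>

lemma sidon_if_d_cap:
  fixes C :: "'a::field vec set"
  assumes CARD: "CARD('a) = 3" and cap: "d_cap 2 n C"
  shows "sidon C"
proof -
  interpret vec_space "TYPE('a)" n .
  have C: "x \<in> carrier_vec n" if "x \<in> C" for x using that cap by (auto simp: d_cap_def)
  have no_flat: False
    if "S \<subseteq> C" "card S = k + 2" "k = 1 \<or> k = 2" "p \<in> carrier_vec n" "finite B" "card B = k"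
      "B \<subseteq> carrier_vec n" "lin_indpt B" "S \<subseteq> (\<lambda>w. p + w) ` span B" for S B k p
  proof -
    have "flat n k ((\<lambda>w. p + w) ` span B)" using flat_span[of p B] that by simp
    moreover have "k \<in> {1..2}" using that by auto
    ultimately show False using cap that unfolding d_cap_def by blast
  qed
  \<comment> \<open>In characteristic three, s + s = -s.\<close>
  have double: "s = t" if "s + s = t + t" for s t :: 'a
    using that three_times_eq_0[OF CARD, of s] three_times_eq_0[OF CARD, of t] by (metis add_left_cancel)
  have add_index: "x $ i + y $ i = z $ i + w $ i"
    if "x \<in> C" "y \<in> C" "z \<in> C" "w \<in> C" "x + y = z + w" "i < n" for x y z w i
  proof -
    have "(x + y) $ i = (z + w) $ i" using that by simp
    then show ?thesis using C[OF that(1)] C[OF that(2)] C[OF that(3)] C[OF that(4)] that(6) by simp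
  qed
  have diff_nonzero: "y - x \<noteq> 0\<^sub>v n" if "x \<in> C" "y \<in> C" "y \<noteq> x" for x y
  proof
    assume eq: "y - x = 0\<^sub>v n"
    note car = C[OF that(1)] C[OF that(2)]
    have "y = x"
    proof (rule eq_vecI)
      fix i assume "i < dim_vec x"
      then have i: "i < n" using car by simp
      have "(y - x) $ i = 0" using eq i by simp
      then show "y $ i = x $ i" using i car by simp
    qed (use car in simp)
    then show False using that by simp
  qed
  \<comment> \<open>Otherwise, with u = y - x, the points x, y = x + u and z = x - u are distinct
    and lie on the line through x in direction u.\<close>
  have line: "y = x" if xyz: "x \<in> C" "y \<in> C" "z \<in> C" and eq: "x + x = y + z" for x y z
  proof (rule ccontr)
    assume neq: "y \<noteq> x"
    note car = C[OF xyz(1)] C[OF xyz(2)] C[OF xyz(3)]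
    note ai = add_index[OF xyz(1,1,2,3) eq]
    have "z \<noteq> x"
    proof
      assume "z = x"
      then have "y = x" using car ai by (intro eq_vecI) auto
      then show False using neq by simp
    qed
    have "y \<noteq> z"
    proof
      assume "y = z"
      then have "x $ i = z $ i" if "i < n" for i
        using double[of "x $ i" "z $ i"] ai[OF that] by simp
      then have "x = z" using car by (intro eq_vecI) auto
      then show False using \<open>z \<noteq> x\<close> by simp
    qed
    define u where "u = y - x"
    have u: "u \<in> carrier_vec n" using car by (simp add: u_def)
    have z: "z = x + - 1 \<cdot>\<^sub>v u"
    proof (rule eq_vecI)
      fix i assume "i < dim_vec (x + - 1 \<cdot>\<^sub>v u)"
      then have i: "i < n" using u car by simp
      show "z $ i = (x + - 1 \<cdot>\<^sub>v u) $ i"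
        using ai[OF i] i car u by (simp add: u_def algebra_simps)
    qed (use car u in simp)
    have y: "y = x + u" using car by (intro eq_vecI) (auto simp: u_def)
    have x: "x = x + 0\<^sub>v n" using car by simp
    interpret sp: LinearCombinations.submodule class_ring "span {u}" V
      by (rule span_is_submodule) (use u in simp)
    have su: "u \<in> span {u}" using in_own_span[of "{u}"] u by simp
    then have "- 1 \<cdot>\<^sub>v u \<in> span {u}" using sp.smult_closed[of "- 1" u] by simp
    moreover have "0\<^sub>v n \<in> span {u}" using sp.zero_closed by simp
    ultimately have "{x, y, z} \<subseteq> (\<lambda>w. x + w) ` span {u}" using su x y z by blast
    moreover have "card {x, y, z} = 1 + 2" using neq \<open>z \<noteq> x\<close> \<open>y \<noteq> z\<close> by auto
    ultimately show False
      using no_flat[of "{x, y, z}" 1 x "{u}"] lin_indpt_singleton[OF u] diff_nonzero[of x y] xyz car u neq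
      by (simp add: u_def)
  qed
  show ?thesis unfolding sidon_def
  proof (intro ballI impI)
    fix a b c d
    assume abcd: "a \<in> C" "b \<in> C" "c \<in> C" "d \<in> C" and eq: "a + b = c + d"
    note car = C[OF abcd(1)] C[OF abcd(2)] C[OF abcd(3)] C[OF abcd(4)]
    note ai = add_index[OF abcd eq]
    have comm: "c + d = d + c" "a + b = b + a" using car by (simp_all add: comm_add_vec)
    show "a = c \<and> b = d \<or> a = d \<and> b = c"
    proof (cases "a = b \<or> c = d")
      case True
      then show ?thesis
      proof
        assume "a = b"
        then show ?thesis using line[of a c d] line[of a d c] abcd eq comm by metis
      next
        assume "c = d"
        then show ?thesis using line[of c a b] line[of c b a] abcd eq comm by metis
      qed
    next
      case False
      have cancel: "y = w" if "x \<in> C" "y \<in> C" "w \<in> C" "x + y = x + w" for x y w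
        using add_index[OF that(1,2,1,3,4)] C[OF that(2)] C[OF that(3)] by (intro eq_vecI) auto
      show ?thesis
      proof (cases "a = c \<or> a = d \<or> b = c \<or> b = d")
        case True
        then show ?thesis using cancel abcd eq comm by metis
      next
        \<comment> \<open>The four points form a parallelogram with diagonals ab and cd. Seen from
          a, its sides are u and v, so b = a + u + v lies in the plane that they span.\<close>
        case distinct: False
        define u where "u = c - a"
        define v where "v = d - a"
        have uv: "u \<in> carrier_vec n" "v \<in> carrier_vec n" using car by (auto simp: u_def v_def)
        have c: "c = a + u" using car by (intro eq_vecI) (auto simp: u_def)
        have d: "d = a + v" using car by (intro eq_vecI) (auto simp: v_def)
        have b: "b = a + (u + v)"
        proof (rule eq_vecI)
          fix i assume "i < dim_vec (a + (u + v))"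
          then have i: "i < n" using uv by simp
          have "b $ i = c $ i + d $ i - a $ i" using ai[OF i] by (simp add: algebra_simps)
          then show "b $ i = (a + (u + v)) $ i"
            using i car uv by (simp add: u_def v_def)
        qed (use car uv in simp)
        have a: "a = a + 0\<^sub>v n" using car by simp
        have u0: "u \<noteq> 0\<^sub>v n" using diff_nonzero[of a c] abcd distinct by (auto simp: u_def)
        \<comment> \<open>The plane does not degenerate: the factors 0, 1 and -1 would mean d = a, c
          = d and a = b.\<close>
        have vu: "v \<noteq> e \<cdot>\<^sub>v u" for e
        proof
          assume v: "v = e \<cdot>\<^sub>v u"
          show False
          proof (rule field_3_cases[OF CARD, of e])
            assume "e = 0"
            then have "v = 0\<^sub>v n" using v uv by (simp add: smult_l_null)
            then show False using diff_nonzero[of a d] abcd distinct by (auto simp: v_def)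
          next
            assume "e = 1"
            then show False using v c d False by simp
          next
            assume "e = - 1"
            then have "u + v = 0\<^sub>v n" using v uv by (intro eq_vecI) auto
            then show False using a b False by simp
          qed
        qed
        have "card {u, v} = 2" using vu[of 1] by auto
        interpret sp: LinearCombinations.submodule class_ring "span {u, v}" V
          by (rule span_is_submodule) (use uv in simp)
        have su: "u \<in> span {u, v}" "v \<in> span {u, v}" using in_own_span[of "{u, v}"] uv by auto
        then have "u + v \<in> span {u, v}" using sp.m_closed by simp
        moreover have "0\<^sub>v n \<in> span {u, v}" using sp.zero_closed by simp
        ultimately have "{a, b, c, d} \<subseteq> (\<lambda>w. a + w) ` span {u, v}" using su a b c d by blast
        moreover have "card {a, b, c, d} = 2 + 2" using False distinct by auto
        ultimately show ?thesis
          using no_flat[of "{a, b, c, d}" 2 a "{u, v}"] lin_indpt_pair[OF uv(1) u0 uv(2) vu]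
            abcd car uv \<open>card {u, v} = 2\<close> by simp
      qed
    qed
  qed
qed

section \<open>The parabola\<close>

text \<open>Eliminating y turns the difference of the two square sums into 2 (x - z) (x -
  w).\<close>

lemma sum_and_square_sum_determine_pair:
  fixes x y z w :: "'a::field"
  assumes "(2 :: 'a) \<noteq> 0" and sum: "x + y = z + w" and sq: "x\<^sup>2 + y\<^sup>2 = z\<^sup>2 + w\<^sup>2"
  shows "(x = z \<and> y = w) \<or> (x = w \<and> y = z)"
proof -
  have y: "y = z + w - x" using sum by (simp add: algebra_simps)
  have "2 * ((x - z) * (x - w)) = x\<^sup>2 + y\<^sup>2 - (z\<^sup>2 + w\<^sup>2)"
    unfolding y by (simp add: algebra_simps power2_eq_square)
  then have "(x - z) * (x - w) = 0" using sq assms(1) by simp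
  then show ?thesis using y by auto
qed

lemma ex_sidon:
  assumes "CARD('a::field) = 3"
  shows "\<exists>C :: 'a vec set. C \<subseteq> carrier_vec (k + k) \<and> sidon C \<and> card C = 3 ^ k"
proof (cases "k = 0")
  \<comment> \<open>For k = 0 the equation defining \<open>K\<close> reads x = x, so
    \<open>K\<close> would be the entire algebraic closure; a single point serves instead.\<close>
  case True
  then show ?thesis by (intro exI[of _ "{0\<^sub>v 0}"]) (auto simp: sidon_def)
next
  case False
  define K where "K = {x :: 'a alg_closure. x ^ (3 ^ k) = x}"
  obtain c :: "'a alg_closure \<Rightarrow> 'a vec" where c: "bij_betw c K (carrier_vec k)"
    and add: "\<And>x y. x \<in> K \<Longrightarrow> y \<in> K \<Longrightarrow> c (x + y) = c x + c y"
    using field_3_additive_coordinates[OF assms, of k] False unfolding K_def by blast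
  note CHAR = CHAR_eq_3[OF assms]
  have two: "(2 :: 'a alg_closure) \<noteq> 0"
    using of_nat_eq_0_iff_char_dvd[where 'a = "'a alg_closure", of 2] by (simp add: CHAR)
  have car: "c x \<in> carrier_vec k" if "x \<in> K" for x using bij_betwE[OF c] that by blast
  have inj: "c x = c y \<longleftrightarrow> x = y" if "x \<in> K" "y \<in> K" for x y
    using bij_betw_imp_inj_on[OF c] that by (simp add: inj_on_eq_iff)
  have addK: "x + y \<in> K" if "x \<in> K" "y \<in> K" for x y
    using freshmans_dream'[of "3 ^ k" k x y] that by (simp add: CHAR K_def)
  have sqK: "x\<^sup>2 \<in> K" if "x \<in> K" for x
  proof -
    have "(x\<^sup>2) ^ (3 ^ k) = (x ^ (3 ^ k))\<^sup>2" by (simp add: power_mult[symmetric] mult.commute)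
    then show ?thesis using that by (simp add: K_def)
  qed
  \<comment> \<open>The parabola, with each of its two coordinates in \<open>K\<close> written out
    as k coordinates over \<open>'a\<close>. As \<open>c\<close> is additive and injective on
    \<open>K\<close>, an equation of sums can be pulled back to \<open>K\<close>.\<close>
  let ?g = "\<lambda>x. c x @\<^sub>v c (x\<^sup>2)"
  have g_add: "?g x + ?g y = c (x + y) @\<^sub>v c (x\<^sup>2 + y\<^sup>2)" if "x \<in> K" "y \<in> K" for x y
    using append_vec_add[OF car car car car, of x y "x\<^sup>2" "y\<^sup>2"] that sqK add by simp
  have "sidon (?g ` K)"
    unfolding sidon_def
  proof (intro ballI impI)
    fix p q r s assume "p \<in> ?g ` K" "q \<in> ?g ` K" "r \<in> ?g ` K" "s \<in> ?g ` K" and eq: "p + q = r + s"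
    then obtain x y z w where K: "x \<in> K" "y \<in> K" "z \<in> K" "w \<in> K"
      and p: "p = ?g x" "q = ?g y" "r = ?g z" "s = ?g w" by blast
    have "c (x + y) @\<^sub>v c (x\<^sup>2 + y\<^sup>2) = c (z + w) @\<^sub>v c (z\<^sup>2 + w\<^sup>2)"
      using eq p g_add K by simp
    then have "c (x + y) = c (z + w)" "c (x\<^sup>2 + y\<^sup>2) = c (z\<^sup>2 + w\<^sup>2)"
      using append_vec_eq[OF car[OF addK] car[OF addK], of x y z w] K by simp_all
    then have "x + y = z + w" "x\<^sup>2 + y\<^sup>2 = z\<^sup>2 + w\<^sup>2"
      using inj addK sqK K by simp_all
    then have "(x = z \<and> y = w) \<or> (x = w \<and> y = z)"
      by (rule sum_and_square_sum_determine_pair[OF two])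
    then show "p = r \<and> q = s \<or> p = s \<and> q = r" using p by auto
  qed
  moreover have "?g ` K \<subseteq> carrier_vec (k + k)" using car sqK by auto
  moreover have "card (?g ` K) = 3 ^ k"
  proof -
    have "inj_on ?g K"
      using append_vec_eq[OF car car] inj by (auto simp: inj_on_def)
    then have "card (?g ` K) = card K" by (rule card_image)
    also have "\<dots> = card (carrier_vec k :: 'a vec set)" by (rule bij_betw_same_card[OF c])
    finally show ?thesis using card_carrier_vec_finite(2)[OF finite_UNIV_if_CARD_eq_3[OF assms]] assms by simp
  qed
  ultimately show ?thesis by blast
qed

section \<open>The maximum size in even dimension\<close>

theorem theorem3p4:
  fixes n :: nat
  assumes "CARD('a::field) = 3"
    and "even n"
  shows "max_cap TYPE('a) 2 n = 3 ^ (n div 2)"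
proof -
  let ?k = "n div 2"
  have n: "n = ?k + ?k" using assms(2) by auto
  note finU = finite_UNIV_if_CARD_eq_3[OF assms(1)]
  note fin = card_carrier_vec_finite(1)[OF finU, of n]
  show ?thesis
    unfolding max_cap_def
  proof (rule Max_eqI)
    have "{card C | C :: 'a vec set. d_cap 2 n C} \<subseteq> card ` Pow (carrier_vec n :: 'a vec set)"
      by (auto simp: d_cap_def)
    then show "finite {card C | C :: 'a vec set. d_cap 2 n C}"
      using fin by (meson finite_Pow_iff finite_imageI finite_subset)
  next
    fix m assume "m \<in> {card C | C :: 'a vec set. d_cap 2 n C}"
    then obtain C :: "'a vec set" where C: "m = card C" "d_cap 2 n C" by blast
    have "C \<subseteq> carrier_vec n" using C(2) by (simp add: d_cap_def)
    \<comment> \<open>The whole space is its own translate by 0, so the count of differences applies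
      to it.\<close>
    moreover have "(\<lambda>w. 0\<^sub>v n + w) ` carrier_vec n = (\<lambda>w. w) ` (carrier_vec n :: 'a vec set)"
      by (rule image_cong) simp_all
    ultimately have "card C * (card C - 1) < card (carrier_vec n :: 'a vec set)"
      using fin sidon_if_d_cap[OF assms(1) C(2)]
      by (intro card_sidon_less[where p = "0\<^sub>v n" and n = n]) auto
    also have "\<dots> = 3 ^ ?k * 3 ^ ?k"
      using card_carrier_vec_finite(2)[OF finU] assms(1) by (subst n) (simp add: power_add)
    finally have less: "m * (m - 1) < 3 ^ ?k * 3 ^ ?k" using C(1) by simp
    show "m \<le> 3 ^ ?k"
    proof (rule ccontr)
      assume "\<not> m \<le> 3 ^ ?k"
      \<comment> \<open>Exceeding 3^k by at least 1 makes both factors m and m - 1 at least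
        3^k.\<close>
      then have "3 ^ ?k * 3 ^ ?k \<le> m * (m - 1)" by (intro mult_mono) auto
      then show False using less by simp
    qed
  next
    obtain C :: "'a vec set" where C: "C \<subseteq> carrier_vec n" "sidon C" "card C = 3 ^ ?k"
      using ex_sidon[OF assms(1), of ?k, folded n] by blast
    have "d_cap 2 n C" by (rule d_cap_if_sidon[OF assms(1) C(1,2)])
    then show "3 ^ ?k \<in> {card C | C :: 'a vec set. d_cap 2 n C}" using C(3)[symmetric] by blast
  qed
qed

end
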